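(* Let $n\ge 4$ and let $B$ be the $(n-1)\times(n-1)$ real matrix with entries $B_{ij}=0$ unless $|i-j|=1$, and for $1\le i\le n-2$: $B_{i,i+1}=2$ if $i=n-2$ and $B_{i,i+1}=1$ otherwise; $B_{i+1,i}=2$ if $i=1$ and $B_{i+1,i}=1$ otherwise. Let $W(B)=\begin{bmatrix} e_{n-1} & Be_{n-1} & \cdots & B^{n-2}e_{n-1}\end{bmatrix}$, where $e_{n-1}$ is the all-ones vector of length $n-1$. Then $\operatorname{rank}W(B)=\lfloor n/2\rfloor$.
   Context: $B$ is the tridiagonal matrix with zero diagonal, all super- and sub-diagonal entries equal to $1$ except that the $(2,1)$ entry and the $(n-2,n-1)$ entry equal $2$. It is the divisor matrix of the equitable partition $\{\{1,2\},\{3\},\ldots,\{n-1\},\{n,n+1\}\}$ of the extended Dynkin graph $\tilde{D}_n$. *)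

theory Defs
  imports "Jordan_Normal_Form.DL_Rank"
begin

(* Row i and column j are numbered from 1 here. *)
definition divisor_entry :: "nat \<Rightarrow> nat \<Rightarrow> nat \<Rightarrow> real" where
  "divisor_entry n i j =
     (if j = i + 1 then (if i = n - 2 then 2 else 1)
      else if i = j + 1 then (if j = 1 then 2 else 1)
      else 0)"

(* Matrix positions are numbered from 0, hence the shift of both indices. *)
definition divisor_matrix :: "nat \<Rightarrow> real mat" where
  "divisor_matrix n = mat (n - 1) (n - 1) (\<lambda>(i, j). divisor_entry n (i + 1) (j + 1))"

definition ones_vec :: "nat \<Rightarrow> real vec" where
  "ones_vec m = vec m (\<lambda>_. 1)"

definition walk_matrix :: "real mat \<Rightarrow> real mat" where
  "walk_matrix A =
     mat_of_cols (dim_row A)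
       (map (\<lambda>k. (A ^\<^sub>m k) *\<^sub>v ones_vec (dim_row A)) [0..<dim_row A])"

end

theory Submission
  imports Defs Complex_Main
begin

text \<open>
  Reversing the order of the coordinates commutes with the matrix and fixes the all-ones vector, so
  every column of the walk matrix is a palindrome, and the palindromes form a space of dimension
  \<open>\<lfloor>n/2\<rfloor>\<close>. Conversely, put \<open>N = n - 2\<close> and \<open>\<theta> = 2\<pi>j/N\<close> with
  \<open>0 \<le> j \<le> N/2\<close>. The vector with entries \<open>cos (k\<theta>)\<close>, \<open>0 \<le> k \<le> N\<close>, is a left eigenvector
  for the eigenvalue \<open>2 cos \<theta>\<close>, and its entries have a nonzero sum. These \<open>\<lfloor>n/2\<rfloor>\<close> eigenvalues
  are distinct, and each of them is a root of any polynomial \<open>p\<close> such that \<open>p(B)\<close> kills the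
  all-ones vector. Hence the first \<open>\<lfloor>n/2\<rfloor>\<close> columns are linearly independent.
\<close>

section \<open>Bounds for the rank\<close>

text \<open>Every column of \<open>P * Q\<close> lies in the span of the at most \<open>d\<close>
  columns of \<open>P\<close>, and by the exchange lemma no independent set in that span is
  larger.\<close>

lemma (in vec_space) rank_mult_le_inner_dim:
  assumes P: "P \<in> carrier_mat n d" and Q: "Q \<in> carrier_mat d nc"
  shows "rank (P * Q) \<le> d"
proof -
  have PQ: "P * Q \<in> carrier_mat n nc"
    using P Q by simp
  have "lin_indpt {}"
    by (simp add: lin_dep_def)
  then obtain S where S: "maximal S (\<lambda>T. T \<subseteq> set (cols (P * Q)) \<and> lin_indpt T)" "finite S"
    using maximal_exists_superset[of "set (cols (P * Q))"
        "\<lambda>T. T \<subseteq> set (cols (P * Q)) \<and> lin_indpt T" "{}"]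
    by auto
  then have indpt: "lin_indpt S" and sub: "S \<subseteq> set (cols (P * Q))"
    by (auto simp: maximal_def)
  have colsP: "set (cols P) \<subseteq> carrier_vec n"
    using P cols_dim by blast
  have "set (cols (P * Q)) \<subseteq> span (set (cols P))"
  proof
    fix v assume "v \<in> set (cols (P * Q))"
    then obtain j where j: "j < nc" "v = col (P * Q) j"
      using PQ by (metis carrier_matD(2) cols_length cols_nth in_set_conv_nth)
    have "v = P *\<^sub>v col Q j"
      using j P Q by auto
    then have "v \<in> col_space P"
      using P Q j(1) by (auto simp: col_space_eq[OF P] intro!: bexI[of _ "col Q j"])
    then show "v \<in> span (set (cols P))"
      by (simp add: col_space_def)
  qed
  with sub have "S \<subseteq> span (set (cols P))"
    by blast
  from replacement[OF S(2) _ _ indpt this] colsP have "card S \<le> card (set (cols P))"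
    by auto
  also have "\<dots> \<le> d"
    using P card_length[of "cols P"] by simp
  finally show ?thesis
    using rank_card_indpt[OF PQ S(1)] by simp
qed

text \<open>Independence is a property of the set of columns, which would hide repetitions, so the
  trivial kernel is used twice: for distinctness and for independence.\<close>

lemma (in vec_space) rank_ge_of_trivial_kernel:
  assumes A: "A \<in> carrier_mat n nc" and K: "K \<in> carrier_mat n d"
    and sub: "set (cols K) \<subseteq> set (cols A)"
    and ker: "\<And>c. c \<in> carrier_vec d \<Longrightarrow> K *\<^sub>v c = 0\<^sub>v n \<Longrightarrow> c = 0\<^sub>v d"
  shows "d \<le> rank A"
proof -
  have "distinct (cols K)"
    unfolding distinct_conv_nth
  proof (intro allI impI notI)
    fix i j
    assume *: "i < length (cols K)" "j < length (cols K)" "i \<noteq> j" "cols K ! i = cols K ! j"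
    then have ij: "i < d" "j < d" and eq: "col K i = col K j"
      using K by auto
    have "K *\<^sub>v unit_vec d k = col K k" if "k < d" for k
      using K that by (intro eq_vecI) auto
    \<comment> \<open>Two equal columns would put this nonzero vector into the kernel.\<close>
    then have "K *\<^sub>v (unit_vec d i - unit_vec d j) = col K i - col K j"
      using ij by (simp add: mult_minus_distrib_mat_vec[OF K])
    also have "\<dots> = 0\<^sub>v n"
      using eq K by auto
    finally have "unit_vec d i - unit_vec d j = (0\<^sub>v d :: 'a vec)"
      by (intro ker) auto
    then have "(unit_vec d i - unit_vec d j) $ i = (0\<^sub>v d :: 'a vec) $ i"
      by simp
    then show False
      using ij \<open>i \<noteq> j\<close> by simp
  qed
  moreover from this have "lin_indpt (set (cols K))"
    using lin_depE[OF K] ker by metis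
  ultimately show ?thesis
    using rank_ge_card_indpt[OF A sub] K by (simp add: distinct_card)
qed

section \<open>Walk matrices\<close>

lemma ones_vec_carrier [simp]: "ones_vec m \<in> carrier_vec m"
  by (simp add: ones_vec_def)

lemma walk_matrix_carrier:
  "A \<in> carrier_mat m m \<Longrightarrow> walk_matrix A \<in> carrier_mat m m"
  unfolding walk_matrix_def by (intro carrier_matI) auto

lemma col_walk_matrix:
  assumes A: "A \<in> carrier_mat m m" and j: "j < m"
  shows "col (walk_matrix A) j = (A ^\<^sub>m j) *\<^sub>v ones_vec m"
proof -
  have "(A ^\<^sub>m j) *\<^sub>v ones_vec m \<in> carrier_vec m"
    using pow_carrier_mat[OF A] ones_vec_carrier by (rule mult_mat_vec_carrier)
  then show ?thesis
    using A j unfolding walk_matrix_def by (subst col_mat_of_cols) auto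
qed

text \<open>Each factor \<open>A\<close> moves across the scalar product as its transpose and
  multiplies \<open>u\<close> by \<open>x\<close>.\<close>

lemma left_eigenvector_mult_pow:
  fixes A :: "'a :: comm_ring_1 mat"
  assumes A: "A \<in> carrier_mat m m" and u: "u \<in> carrier_vec m"
    and eig: "transpose_mat A *\<^sub>v u = x \<cdot>\<^sub>v u"
    and v: "v \<in> carrier_vec m"
  shows "u \<bullet> ((A ^\<^sub>m k) *\<^sub>v v) = x ^ k * (u \<bullet> v)"
  using v
proof (induction k arbitrary: v)
  case 0
  then show ?case using A by simp
next
  case (Suc k)
  have "u \<bullet> ((A ^\<^sub>m Suc k) *\<^sub>v v) = u \<bullet> ((A ^\<^sub>m k) *\<^sub>v (A *\<^sub>v v))"
    using A Suc.prems by (simp add: assoc_mult_mat_vec[of _ m m _ m])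
  also have "\<dots> = x ^ k * (u \<bullet> (A *\<^sub>v v))"
    using A Suc.prems by (intro Suc.IH) auto
  also have "u \<bullet> (A *\<^sub>v v) = x * (u \<bullet> v)"
    using transpose_vec_mult_scalar[OF A Suc.prems u] eig u Suc.prems by simp
  finally show ?case by simp
qed

text \<open>Coefficients of a relation among the first \<open>card L\<close> columns define a
  polynomial of degree below \<open>card L\<close>. Pairing the relation with a left eigenvector for
  \<open>x\<close> gives its value at \<open>x\<close> times a nonzero number, so all of
  \<open>L\<close> would be roots.\<close>

lemma card_left_eigenvalues_le_rank_walk_matrix:
  assumes A: "A \<in> carrier_mat m m" and fin: "finite L" and card: "card L \<le> m"
    and eig: "\<And>x. x \<in> L \<Longrightarrow>
      \<exists>u \<in> carrier_vec m. transpose_mat A *\<^sub>v u = x \<cdot>\<^sub>v u \<and> u \<bullet> ones_vec m \<noteq> 0"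
  shows "card L \<le> vec_space.rank m (walk_matrix A)"
proof -
  define d where "d = card L"
  define w where "w k = (A ^\<^sub>m k) *\<^sub>v ones_vec m" for k
  define K where "K = mat_of_cols m (map w [0..<d])"
  have w: "w k \<in> carrier_vec m" for k
    using mult_mat_vec_carrier[OF pow_carrier_mat[OF A] ones_vec_carrier] by (simp add: w_def)
  have K: "K \<in> carrier_mat m d"
    using mat_of_cols_carrier(1)[of m "map w [0..<d]"] by (simp add: K_def)
  have colK: "col K k = w k" if "k < d" for k
    using that w by (simp add: K_def)
  have walk: "walk_matrix A = mat_of_cols m (map w [0..<m])"
    using A unfolding walk_matrix_def w_def by auto
  have "set (cols K) \<subseteq> set (cols (walk_matrix A))"
  proof -
    have "set (map w [0..<k]) \<subseteq> carrier_vec m" for k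
      using w by auto
    then have "cols (mat_of_cols m (map w [0..<k])) = map w [0..<k]" for k
      by (rule cols_mat_of_cols)
    then show ?thesis
      using card by (auto simp: K_def walk d_def)
  qed
  moreover have "c = 0\<^sub>v d" if c: "c \<in> carrier_vec d" and Kc: "K *\<^sub>v c = 0\<^sub>v m" for c
  proof (rule ccontr)
    assume "c \<noteq> 0\<^sub>v d"
    then obtain k where k: "k < d" "c $ k \<noteq> 0"
      using c by (metis carrier_vecD eq_vecI index_zero_vec)
    have root: "(\<Sum>i\<le>d - 1. c $ i * x ^ i) = 0" if "x \<in> L" for x
    proof -
      obtain u where u: "u \<in> carrier_vec m" "transpose_mat A *\<^sub>v u = x \<cdot>\<^sub>v u" "u \<bullet> ones_vec m \<noteq> 0"
        using eig[OF \<open>x \<in> L\<close>] by blast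
      have "0 = (transpose_mat K *\<^sub>v u) \<bullet> c"
        using transpose_vec_mult_scalar[OF K c u(1)] Kc u(1) by simp
      also have "\<dots> = (\<Sum>i<d. (w i \<bullet> u) * c $ i)"
        using K c colK by (auto simp: scalar_prod_def[of _ c] lessThan_atLeast0 intro!: sum.cong)
      also have "\<dots> = (\<Sum>i<d. c $ i * x ^ i) * (u \<bullet> ones_vec m)"
        unfolding sum_distrib_right
      proof (rule sum.cong[OF refl])
        fix i
        have "w i \<bullet> u = x ^ i * (u \<bullet> ones_vec m)"
          using left_eigenvector_mult_pow[OF A u(1,2) ones_vec_carrier] comm_scalar_prod[OF w u(1)]
          by (simp add: w_def)
        then show "(w i \<bullet> u) * c $ i = c $ i * x ^ i * (u \<bullet> ones_vec m)"
          by simp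
      qed
      finally have "(\<Sum>i<d. c $ i * x ^ i) = 0"
        using u(3) by simp
      \<comment> \<open>Since \<open>k < d\<close> excludes \<open>d = 0\<close>, the sum takes the
        form to which the root bound applies.\<close>
      moreover have "{..<d} = {..d - 1}"
        using k by auto
      ultimately show ?thesis by simp
    qed
    have "finite {x. (\<Sum>i\<le>d - 1. c $ i * x ^ i) = 0}"
      and "card {x. (\<Sum>i\<le>d - 1. c $ i * x ^ i) = 0} \<le> d - 1"
      using polyfun_rootbound[of "\<lambda>i. c $ i" k "d - 1"] k by auto
    moreover have "L \<subseteq> {x. (\<Sum>i\<le>d - 1. c $ i * x ^ i) = 0}"
      using root by blast
    ultimately have "d \<le> d - 1"
      unfolding d_def by (meson card_mono order_trans)
    then show False
      using k by simp
  qed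
  ultimately show ?thesis
    using vec_space.rank_ge_of_trivial_kernel[OF walk_matrix_carrier[OF A] K] by (simp add: d_def)
qed

section \<open>Vectors fixed by reversing the coordinates\<close>

definition palindrome_vec :: "'a vec \<Rightarrow> bool" where
  "palindrome_vec v \<longleftrightarrow> (\<forall>i < dim_vec v. v $ (dim_vec v - 1 - i) = v $ i)"

text \<open>The assumption \<open>sym\<close> says that \<open>A\<close> commutes with the reversal,
  so \<open>A\<close> preserves its fixed vectors; in coordinates this is the substitution of
  \<open>m - 1 - j\<close> for \<open>j\<close>.\<close>

lemma palindrome_mult_mat_vec:
  assumes A: "A \<in> carrier_mat m m" and v: "v \<in> carrier_vec m"
    and sym: "\<And>i j. i < m \<Longrightarrow> j < m \<Longrightarrow> A $$ (m - 1 - i, m - 1 - j) = A $$ (i, j)"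
    and pal: "palindrome_vec v"
  shows "palindrome_vec (A *\<^sub>v v)"
  unfolding palindrome_vec_def
proof (intro allI impI)
  fix i assume "i < dim_vec (A *\<^sub>v v)"
  then have i: "i < m" using A by simp
  have entry: "(A *\<^sub>v v) $ k = (\<Sum>j<m. A $$ (k, j) * v $ j)" if "k < m" for k
    using A v that by (auto simp: scalar_prod_def lessThan_atLeast0)
  have "(A *\<^sub>v v) $ (m - 1 - i) = (\<Sum>j<m. A $$ (m - 1 - i, j) * v $ j)"
    using i by (intro entry) auto
  also have "\<dots> = (\<Sum>j<m. A $$ (m - 1 - i, m - 1 - j) * v $ (m - 1 - j))"
    by (subst sum.nat_diff_reindex[symmetric]) simp
  also have "\<dots> = (\<Sum>j<m. A $$ (i, j) * v $ j)"
    using sym i pal v by (intro sum.cong) (auto simp: palindrome_vec_def)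
  also have "\<dots> = (A *\<^sub>v v) $ i"
    using entry[OF i] by simp
  finally show "(A *\<^sub>v v) $ (dim_vec (A *\<^sub>v v) - 1 - i) = (A *\<^sub>v v) $ i"
    using A by simp
qed

lemma palindrome_pow_mult_mat_vec:
  assumes A: "A \<in> carrier_mat m m" and v: "v \<in> carrier_vec m"
    and sym: "\<And>i j. i < m \<Longrightarrow> j < m \<Longrightarrow> A $$ (m - 1 - i, m - 1 - j) = A $$ (i, j)"
    and pal: "palindrome_vec v"
  shows "palindrome_vec ((A ^\<^sub>m k) *\<^sub>v v)"
  using v pal
proof (induction k arbitrary: v)
  case 0
  then show ?case using A by simp
next
  case (Suc k)
  have "(A ^\<^sub>m Suc k) *\<^sub>v v = (A ^\<^sub>m k) *\<^sub>v (A *\<^sub>v v)"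
    using A Suc.prems by (simp add: assoc_mult_mat_vec[of _ m m _ m])
  then show ?case
    using Suc.IH[of "A *\<^sub>v v"] palindrome_mult_mat_vec[OF A Suc.prems(1) sym Suc.prems(2)]
      A Suc.prems(1) by simp
qed

text \<open>The upper half of the rows determines the matrix, so it factors through dimension
  \<open>(n + 1) div 2\<close>; rounding up accounts for a middle row when \<open>n\<close> is
  odd.\<close>

lemma (in vec_space) rank_le_of_palindrome_cols:
  assumes A: "A \<in> carrier_mat n nc" and pal: "\<And>j. j < nc \<Longrightarrow> palindrome_vec (col A j)"
  shows "rank A \<le> (n + 1) div 2"
proof -
  define d where "d = (n + 1) div 2"
  \<comment> \<open>\<open>P\<close> sends row \<open>i\<close> to the representative of the pair
    \<open>i\<close>, \<open>n - 1 - i\<close> in the upper half, and \<open>Q\<close> is that upper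
    half of \<open>A\<close>.\<close>
  define P :: "'a mat" where "P = mat n d (\<lambda>(i, k). if min i (n - 1 - i) = k then 1 else 0)"
  define Q where "Q = mat d nc (\<lambda>(k, j). A $$ (k, j))"
  have PQ: "P \<in> carrier_mat n d" "Q \<in> carrier_mat d nc"
    by (auto simp: P_def Q_def)
  have "A = P * Q"
  proof (rule eq_matI)
    fix i j assume "i < dim_row (P * Q)" "j < dim_col (P * Q)"
    then have ij: "i < n" "j < nc"
      using PQ by auto
    have r: "min i (n - 1 - i) < d"
      using ij by (auto simp: d_def min_def)
    have "(P * Q) $$ (i, j) = (\<Sum>k<d. (if min i (n - 1 - i) = k then 1 else 0) * A $$ (k, j))"
      using ij by (auto simp: P_def Q_def scalar_prod_def lessThan_atLeast0 intro!: sum.cong)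
    also have "\<dots> = (\<Sum>k<d. if min i (n - 1 - i) = k then A $$ (k, j) else 0)"
      by (intro sum.cong) auto
    also have "\<dots> = A $$ (min i (n - 1 - i), j)"
      using r by simp
    also have "\<dots> = A $$ (i, j)"
      using pal[OF ij(2)] A ij by (auto simp: palindrome_vec_def min_def)
    finally show "A $$ (i, j) = (P * Q) $$ (i, j)" ..
  qed (use A PQ in auto)
  then show ?thesis
    using rank_mult_le_inner_dim[OF PQ] by (simp add: d_def)
qed

section \<open>The divisor matrix\<close>

lemma divisor_matrix_carrier [simp]: "divisor_matrix n \<in> carrier_mat (n - 1) (n - 1)"
  by (simp add: divisor_matrix_def)

lemma divisor_matrix_reverse:
  assumes "i < n - 1" "j < n - 1"
  shows "divisor_matrix n $$ (n - 1 - 1 - i, n - 1 - 1 - j) = divisor_matrix n $$ (i, j)"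
proof -
  define i' j' where "i' = n - 1 - 1 - i" and "j' = n - 1 - 1 - j"
  have "i' < n - 1" "j' < n - 1" "i + i' = n - 2" "j + j' = n - 2"
    using assms by (auto simp: i'_def j'_def)
  \<comment> \<open>Reversal exchanges the superdiagonal with the subdiagonal; the last two
    equivalences match the two doubled entries.\<close>
  moreover from this have "j' = Suc i' \<longleftrightarrow> i = Suc j" "i' = Suc j' \<longleftrightarrow> j = Suc i"
    "Suc i' = n - 2 \<longleftrightarrow> i = 1" "Suc i = n - 2 \<longleftrightarrow> i' = 1"
    by arith+
  ultimately show ?thesis
    using assms unfolding i'_def[symmetric] j'_def[symmetric]
    by (auto simp: divisor_matrix_def divisor_entry_def)
qed

text \<open>Inside, this is \<open>cos ((k-1)\<theta>) + cos ((k+1)\<theta>) = 2 cos \<theta> cos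
  (k\<theta>)\<close>. At the ends the doubled entry replaces the missing neighbour by its mirror
  image: cosine is even about 0, and the hypothesis on \<open>\<theta>\<close> makes it even about
  \<open>k = n - 2\<close>.\<close>

lemma divisor_matrix_left_eigenvector:
  assumes n: "n \<ge> 4" and \<theta>: "sin (real (n - 2) * \<theta>) = 0"
  shows "transpose_mat (divisor_matrix n) *\<^sub>v vec (n - 1) (\<lambda>k. cos (real k * \<theta>)) =
    (2 * cos \<theta>) \<cdot>\<^sub>v vec (n - 1) (\<lambda>k. cos (real k * \<theta>))" (is "?B *\<^sub>v ?u = _")
proof (rule eq_vecI)
  fix i assume "i < dim_vec ((2 * cos \<theta>) \<cdot>\<^sub>v ?u)"
  then have i: "i < n - 1" by simp
  let ?c = "\<lambda>k. cos (real k * \<theta>)"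
  have "(?B *\<^sub>v ?u) $ i = (\<Sum>j<n - 1. divisor_entry n (j + 1) (i + 1) * ?c j)"
    using i by (auto simp: divisor_matrix_def scalar_prod_def lessThan_atLeast0 intro!: sum.cong)
  \<comment> \<open>For \<open>i = 0\<close> the truncated \<open>i - 1\<close> is 0, and the
    coefficient 0 removes that spurious term.\<close>
  also have "\<dots> = (\<Sum>j<n - 1. (if j = i + 1 then (if i = 0 then 2 else 1) * ?c j else 0) +
      (if j = i - 1 then (if i = 0 then 0 else if i = n - 2 then 2 else 1) * ?c j else 0))"
    using n by (intro sum.cong) (auto simp: divisor_entry_def)
  also have "\<dots> = (if i + 1 < n - 1 then (if i = 0 then 2 else 1) * ?c (i + 1) else 0) +
      (if i = 0 then 0 else if i = n - 2 then 2 else 1) * ?c (i - 1)"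
    using i by (simp add: sum.distrib)
  also have "\<dots> = 2 * cos \<theta> * ?c i"
  proof -
    consider "i = 0" | "0 < i" "i < n - 2" | "0 < i" "i = n - 2"
      using i by linarith
    then show ?thesis
    proof cases
      case 1
      then show ?thesis using n by simp
    next
      case 2
      then have "real (i - 1) = real i - 1" "real (i + 1) = real i + 1" "i + 1 < n - 1"
        by auto
      then show ?thesis
        using 2 by (simp add: ring_distribs cos_add cos_diff)
    next
      case 3
      then have "real (i - 1) = real i - 1" "sin (real i * \<theta>) = 0" "\<not> i + 1 < n - 1"
        using \<theta> n by auto
      moreover have "(if i = 0 then 0 else if i = n - 2 then 2 else 1) = (2 :: real)"
        using 3 by simp
      ultimately show ?thesis
        by (simp add: left_diff_distrib cos_diff)
    qed
  qed
  finally show "(?B *\<^sub>v ?u) $ i = ((2 * cos \<theta>) \<cdot>\<^sub>v ?u) $ i"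
    using i by simp
qed (simp add: divisor_matrix_def)

text \<open>The factor \<open>2 * sin (\<theta> / 2)\<close> turns each summand into a difference of
  sines at half-integer multiples of \<open>\<theta>\<close>, and the sum telescopes.\<close>

lemma sum_cos_multiples:
  fixes \<theta> :: real
  shows "2 * sin (\<theta> / 2) * (\<Sum>k<N. cos (real k * \<theta>)) = sin (real N * \<theta> - \<theta> / 2) + sin (\<theta> / 2)"
proof (induction N)
  case 0
  then show ?case by simp
next
  case (Suc N)
  have "2 * sin (\<theta> / 2) * cos (real N * \<theta>) = sin (real N * \<theta> + \<theta> / 2) - sin (real N * \<theta> - \<theta> / 2)"
    by (simp add: sin_add sin_diff)
  moreover have "real (Suc N) * \<theta> - \<theta> / 2 = real N * \<theta> + \<theta> / 2"
    by (simp add: field_simps)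
  ultimately show ?case
    using Suc.IH by (simp add: distrib_left add.commute)
qed

text \<open>For \<open>j > 0\<close> the first \<open>N\<close> terms cover whole periods and
  cancel, leaving the term 1 at \<open>k = N\<close>; for \<open>j = 0\<close> all terms are
  1.\<close>

lemma sum_cos_period_pos:
  assumes N: "N > 0" and j: "2 * j \<le> N"
  defines "\<theta> \<equiv> 2 * pi * real j / real N"
  shows "(\<Sum>k<N + 1. cos (real k * \<theta>)) > 0"
proof (cases "j = 0")
  case True
  then show ?thesis by (simp add: \<theta>_def)
next
  case False
  have N\<theta>: "real N * \<theta> = 2 * real j * pi"
    using N by (simp add: \<theta>_def)
  have period: "sin (real N * \<theta>) = 0" "cos (real N * \<theta>) = 1"
    unfolding N\<theta> using sin_npi[of "2 * j"] cos_npi[of "2 * j"] by simp_all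
  have "\<theta> / 2 > 0" "\<theta> / 2 < pi"
    using False j N by (auto simp: \<theta>_def field_simps)
  then have "sin (\<theta> / 2) > 0"
    by (rule sin_gt_zero)
  moreover have "2 * sin (\<theta> / 2) * (\<Sum>k<N. cos (real k * \<theta>)) = 0"
    unfolding sum_cos_multiples by (simp add: sin_diff period)
  ultimately have "(\<Sum>k<N. cos (real k * \<theta>)) = 0"
    by simp
  then show ?thesis
    using period by simp
qed

theorem theorem2p5:
  fixes n :: nat
  assumes "n \<ge> 4"
  shows "vec_space.rank (n - 1) (walk_matrix (divisor_matrix n)) = n div 2"
proof (rule antisym)
  let ?B = "divisor_matrix n"
  have "palindrome_vec (ones_vec (n - 1))"
    by (simp add: palindrome_vec_def ones_vec_def)
  then have pal: "palindrome_vec ((?B ^\<^sub>m k) *\<^sub>v ones_vec (n - 1))" for k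
    by (intro palindrome_pow_mult_mat_vec[OF divisor_matrix_carrier ones_vec_carrier]
        divisor_matrix_reverse)
  have "palindrome_vec (col (walk_matrix ?B) j)" if "j < n - 1" for j
    using pal col_walk_matrix[OF divisor_matrix_carrier that] by simp
  then have "vec_space.rank (n - 1) (walk_matrix ?B) \<le> (n - 1 + 1) div 2"
    by (rule vec_space.rank_le_of_palindrome_cols[OF walk_matrix_carrier[OF divisor_matrix_carrier]])
  then show "vec_space.rank (n - 1) (walk_matrix ?B) \<le> n div 2"
    using assms by simp
next
  let ?B = "divisor_matrix n"
  define N where "N = n - 2"
  \<comment> \<open>Odd multiples of \<open>pi / N\<close> also give left eigenvectors, but these
    are antisymmetric under reversal and have entry sum 0; hence only even multiples are
    taken.\<close>
  define \<theta> where "\<theta> j = 2 * pi * real j / real N" for j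
  define L where "L = (\<lambda>j. 2 * cos (\<theta> j)) ` {..N div 2}"
  have N: "N > 0" "n - 1 = N + 1" "n div 2 = N div 2 + 1"
    using assms by (auto simp: N_def)
  have "inj_on (\<lambda>j. 2 * cos (\<theta> j)) {..N div 2}"
  proof (rule inj_onI)
    fix i j assume ij: "i \<in> {..N div 2}" "j \<in> {..N div 2}" "2 * cos (\<theta> i) = 2 * cos (\<theta> j)"
    \<comment> \<open>The bound \<open>k \<le> N div 2\<close> keeps the angles in the interval
      where cosine is injective.\<close>
    have "0 \<le> \<theta> k \<and> \<theta> k \<le> pi" if "k \<in> {..N div 2}" for k
    proof -
      have "2 * real k \<le> real N" using that by auto
      then show ?thesis using N(1) by (simp add: \<theta>_def field_simps)
    qed
    then have "\<theta> i = \<theta> j"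
      using ij by (intro cos_inj_pi[of "\<theta> i" "\<theta> j"]) auto
    then show "i = j"
      using N(1) by (simp add: \<theta>_def)
  qed
  then have card: "card L = n div 2"
    using N(3) by (simp add: L_def card_image)
  have "card L \<le> vec_space.rank (n - 1) (walk_matrix ?B)"
  proof (rule card_left_eigenvalues_le_rank_walk_matrix[OF divisor_matrix_carrier])
    show "finite L" by (simp add: L_def)
    show "card L \<le> n - 1" using card assms by simp
    fix x assume "x \<in> L"
    then obtain j where "j \<le> N div 2" and x: "x = 2 * cos (\<theta> j)"
      by (auto simp: L_def)
    then have j: "2 * j \<le> N"
      by simp
    let ?u = "vec (n - 1) (\<lambda>k. cos (real k * \<theta> j))"
    have "real (n - 2) * \<theta> j = real (2 * j) * pi"
      using N(1) by (simp add: \<theta>_def N_def)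
    then have "sin (real (n - 2) * \<theta> j) = 0"
      by (simp only: sin_npi)
    then have "transpose_mat ?B *\<^sub>v ?u = x \<cdot>\<^sub>v ?u"
      using divisor_matrix_left_eigenvector[OF assms] x by simp
    moreover have "?u \<bullet> ones_vec (n - 1) = (\<Sum>k<N + 1. cos (real k * \<theta> j))"
      using N(2) by (simp add: scalar_prod_def ones_vec_def lessThan_atLeast0 del: sum.lessThan_Suc)
    then have "?u \<bullet> ones_vec (n - 1) \<noteq> 0"
      using sum_cos_period_pos[OF N(1) j] by (simp add: \<theta>_def)
    ultimately show "\<exists>u \<in> carrier_vec (n - 1).
        transpose_mat ?B *\<^sub>v u = x \<cdot>\<^sub>v u \<and> u \<bullet> ones_vec (n - 1) \<noteq> 0"
      by (intro bexI[of _ ?u]) auto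
  qed
  then show "n div 2 \<le> vec_space.rank (n - 1) (walk_matrix ?B)"
    using card by simp
qed

end
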